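(* Let $S=(a_1,a_2,\dots)$ be a non-decreasing sequence of positive integers and let $G$ be a finite graph with $|V(G)|=n\geq 1$ and $|E(G)|=m$. Then $1+\Delta(G)\leq \chi_S''(G)\leq n+m$. Moreover, $\chi_S''(G)=n+m$ if and only if $G$ is connected and $a_1\geq \max_{A,B\in V(G)\cup E(G)} d(A,B)$, where the maximum is over pairs of distinct elements (and is $0$ if there are none).
   Context: All graphs are simple and undirected; $\Delta(G)$ is the maximum degree. For vertices $u,v$ of $G$, $d(u,v)$ is the usual shortest-path distance (infinite if $u,v$ lie in different components). For a vertex $u$ and an edge $ab$, $d(u,ab)=d(ab,u)=\min\{d(u,a),d(u,b)\}+1$. For two distinct edges $ab,cd$, $d(ab,cd)=\min\{d(a,c),d(a,d),d(b,c),d(b,d)\}+1$. For a non-decreasing infinite sequence $S=(a_1,a_2,\ldots)$ of positive integers, an $S$-packing total coloring of $G$ using $k$ colors is a map $c:V(G)\cup E(G)\to\{1,\ldots,k\}$ such that any two distinct elements $A,B\in V(G)\cup E(G)$ with $c(A)=c(B)=i$ satisfy $d(A,B)>a_i$. The $S$-packing total chromatic number $\chi_S''(G)$ is the smallest $k$ for which one exists. *)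

theory Defs
  imports Main "HOL-Library.Extended_Nat" "HOL-Library.FuncSet"
begin

definition simple_graph :: "'a set \<Rightarrow> 'a set set \<Rightarrow> bool" where
  "simple_graph V E \<longleftrightarrow> (\<forall>e\<in>E. e \<subseteq> V \<and> card e = 2)"

definition degree :: "'a set set \<Rightarrow> 'a \<Rightarrow> nat" where
  "degree E v = card {e \<in> E. v \<in> e}"

definition max_degree :: "'a set \<Rightarrow> 'a set set \<Rightarrow> nat" where
  "max_degree V E = Max (degree E ` V)"

definition is_path :: "'a set \<Rightarrow> 'a set set \<Rightarrow> 'a \<Rightarrow> 'a list \<Rightarrow> 'a \<Rightarrow> bool" where
  "is_path V E u p v \<longleftrightarrow> p \<noteq> [] \<and> hd p = u \<and> last p = v \<and> set p \<subseteq> V \<and> distinct p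
     \<and> successively (\<lambda>x y. {x, y} \<in> E) p"

definition graph_connected :: "'a set \<Rightarrow> 'a set set \<Rightarrow> bool" where
  "graph_connected V E \<longleftrightarrow> (\<forall>u\<in>V. \<forall>v\<in>V. \<exists>p. is_path V E u p v)"

(* The length of a path counts its edges. The infimum of the empty set of enat is \<infinity>,
   so vertices in different components are at infinite distance. *)
definition vdist :: "'a set \<Rightarrow> 'a set set \<Rightarrow> 'a \<Rightarrow> 'a \<Rightarrow> enat" where
  "vdist V E u v = (INF p\<in>{p. is_path V E u p v}. enat (length p - 1))"

(* V(G) \<union> E(G) is rendered as the disjoint sum V <+> E. The last equation is
   meaningful for distinct edges only. *)
fun tdist :: "'a set \<Rightarrow> 'a set set \<Rightarrow> 'a + 'a set \<Rightarrow> 'a + 'a set \<Rightarrow> enat" where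
  "tdist V E (Inl u) (Inl v) = vdist V E u v"
| "tdist V E (Inl u) (Inr e) = Min ((\<lambda>a. vdist V E u a) ` e) + 1"
| "tdist V E (Inr e) (Inl u) = Min ((\<lambda>a. vdist V E u a) ` e) + 1"
| "tdist V E (Inr e) (Inr f) = Min ((\<lambda>(a, b). vdist V E a b) ` (e \<times> f)) + 1"

(* As distances are nonnegative, inserting 0 only matters if there are no two distinct elements. *)
definition max_tdist :: "'a set \<Rightarrow> 'a set set \<Rightarrow> enat" where
  "max_tdist V E = Max (insert 0 {tdist V E A B | A B. A \<in> V <+> E \<and> B \<in> V <+> E \<and> A \<noteq> B})"

(* The sequence (a_1, a_2, ...) is a function on nat whose value at 0 is never used. *)
definition packing_seq :: "(nat \<Rightarrow> nat) \<Rightarrow> bool" where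
  "packing_seq S \<longleftrightarrow> (\<forall>i\<ge>1. 0 < S i) \<and> mono_on {1..} S"

definition packing_total_coloring ::
  "(nat \<Rightarrow> nat) \<Rightarrow> 'a set \<Rightarrow> 'a set set \<Rightarrow> nat \<Rightarrow> ('a + 'a set \<Rightarrow> nat) \<Rightarrow> bool" where
  "packing_total_coloring S V E k c \<longleftrightarrow> c \<in> (V <+> E) \<rightarrow> {1..k} \<and>
     (\<forall>A\<in>V <+> E. \<forall>B\<in>V <+> E. \<forall>i. A \<noteq> B \<longrightarrow> c A = i \<longrightarrow> c B = i \<longrightarrow> tdist V E A B > enat (S i))"

definition packing_total_chromatic_number ::
  "(nat \<Rightarrow> nat) \<Rightarrow> 'a set \<Rightarrow> 'a set set \<Rightarrow> nat" where
  "packing_total_chromatic_number S V E = (LEAST k. \<exists>c. packing_total_coloring S V E k c)"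

(* For finite graphs the minimum above is taken over a nonempty set. *)
lemma packing_total_coloring_exists:
  assumes "finite V" "finite E"
  shows "\<exists>c. packing_total_coloring S V E (card V + card E) c"
proof -
  have "finite (V <+> E)" "card (V <+> E) = card V + card E"
    using assms by (simp_all add: card_Plus)
  then obtain c where "bij_betw c (V <+> E) {1..card V + card E}"
    by (metis finite_same_card_bij finite_atLeastAtMost card_atLeastAtMost diff_Suc_1 One_nat_def)
  then have "packing_total_coloring S V E (card V + card E) c"
    unfolding packing_total_coloring_def bij_betw_def inj_on_def by blast
  then show ?thesis by blast
qed

end

theory Submission
  imports Defs
begin

text \<open>
  A vertex of maximum degree and the edges at it are pairwise at distance at most 1. Every entry
  of the sequence is at least 1, so no two of them can share a colour
  (\<open>degree_less_num_colors\<close>); this is the lower bound. Giving all elements different colours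
  always works; this is the upper bound.

  Equality in the upper bound means that no colour can ever be used twice. As the sequence is
  non-decreasing, the first colour is the least restrictive one. If all distances are at most
  \<open>S 1\<close>, then every colouring is injective
  (\<open>card_le_colors_if_close\<close>) and uses at least \<open>n + m\<close> colours. If some pair is farther
  apart than \<open>S 1\<close>, that pair can share colour 1 and a colour is saved
  (\<open>coloring_merging_pair\<close>). Hence equality holds exactly if \<open>S 1\<close> bounds all distances;
  as vertices in different components are at distance \<open>\<infinity>\<close>, this bound
  already forces the graph to be connected (\<open>graph_connected_if_close\<close>).
\<close>

section \<open>Distances\<close>

lemma simple_graph_finite_edges:
  assumes "simple_graph V E" "finite V"
  shows "finite E"
proof (rule finite_subset)
  show "E \<subseteq> Pow V" using assms(1) by (auto simp: simple_graph_def)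
qed (use assms(2) in simp)

lemma is_path_singleton: "u \<in> V \<Longrightarrow> is_path V E u [u] u"
  by (simp add: is_path_def)

lemma is_path_rev:
  assumes "is_path V E u p v"
  shows "is_path V E v (rev p) u"
  using assms by (auto simp: is_path_def hd_rev last_rev insert_commute)

lemma vdist_self: "u \<in> V \<Longrightarrow> vdist V E u u = 0"
proof -
  assume "u \<in> V"
  then have "vdist V E u u \<le> enat (length [u] - 1)"
    unfolding vdist_def by (intro INF_lower) (simp add: is_path_singleton)
  then show ?thesis by (simp add: zero_enat_def[symmetric])
qed

lemma vdist_commute: "vdist V E u v = vdist V E v u"
proof -
  have "vdist V E u v \<le> vdist V E v u" for u v
    unfolding vdist_def
  proof (rule INF_mono)
    fix p assume "p \<in> {p. is_path V E v p u}"
    then show "\<exists>q\<in>{q. is_path V E u q v}. enat (length q - 1) \<le> enat (length p - 1)"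
      using is_path_rev[of V E v p u] by (intro bexI[of _ "rev p"]) auto
  qed
  then show ?thesis by (simp add: order_antisym)
qed

lemma ex_path_if_vdist_finite:
  assumes "vdist V E u v < \<infinity>"
  shows "\<exists>p. is_path V E u p v"
proof (rule ccontr)
  assume "\<nexists>p. is_path V E u p v"
  then have "vdist V E u v = \<infinity>" by (simp add: vdist_def top_enat_def)
  with assms show False by simp
qed

lemma tdist_commute: "tdist V E A B = tdist V E B A"
proof (cases A; cases B)
  fix e f assume AB: "A = Inr e" "B = Inr f"
  have "(\<lambda>(a, b). vdist V E a b) ` (e \<times> f) = (\<lambda>(a, b). vdist V E a b) ` (f \<times> e)"
    using vdist_commute[of V E] by (fastforce simp: image_iff)
  with AB show ?thesis by simp
qed (auto simp: vdist_commute)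

lemma tdist_vertex_incident_edge_le:
  assumes "v \<in> V" "v \<in> e" "finite e"
  shows "tdist V E (Inl v) (Inr e) \<le> 1"
proof -
  have "Min ((\<lambda>a. vdist V E v a) ` e) \<le> vdist V E v v"
    using assms by (intro Min_le) auto
  then show ?thesis using assms(1) by (simp add: vdist_self)
qed

lemma tdist_edges_sharing_vertex_le:
  assumes "v \<in> V" "v \<in> e" "v \<in> f" "finite e" "finite f"
  shows "tdist V E (Inr e) (Inr f) \<le> 1"
proof -
  have "Min ((\<lambda>(a, b). vdist V E a b) ` (e \<times> f)) \<le> vdist V E v v"
    using assms by (intro Min_le) force+
  then show ?thesis using assms(1) by (simp add: vdist_self)
qed

lemma max_tdist_le_iff:
  assumes "finite V" "finite E"
  shows "max_tdist V E \<le> d \<longleftrightarrow>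
    (\<forall>A\<in>V <+> E. \<forall>B\<in>V <+> E. A \<noteq> B \<longrightarrow> tdist V E A B \<le> d)"
proof -
  let ?D = "{tdist V E A B | A B. A \<in> V <+> E \<and> B \<in> V <+> E \<and> A \<noteq> B}"
  have "?D \<subseteq> (\<lambda>(A, B). tdist V E A B) ` ((V <+> E) \<times> (V <+> E))"
    by force
  then have "finite ?D"
    by (rule finite_subset) (use assms in simp)
  then show ?thesis by (simp add: max_tdist_def del: tdist.simps) blast
qed

lemma graph_connected_if_close:
  assumes "\<forall>A\<in>V <+> E. \<forall>B\<in>V <+> E. A \<noteq> B \<longrightarrow> tdist V E A B \<le> enat d"
  shows "graph_connected V E"
  unfolding graph_connected_def
proof (intro ballI)
  fix u v assume uv: "u \<in> V" "v \<in> V"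
  have "vdist V E u v < \<infinity>"
  proof (cases "u = v")
    case True
    with uv show ?thesis by (simp add: vdist_self)
  next
    case False
    with uv assms have "tdist V E (Inl u) (Inl v) \<le> enat d" by blast
    then show ?thesis using enat_ile by fastforce
  qed
  then show "\<exists>p. is_path V E u p v" by (rule ex_path_if_vdist_finite)
qed

section \<open>Colourings\<close>

lemma packing_seq_pos: "packing_seq S \<Longrightarrow> i \<ge> 1 \<Longrightarrow> 1 \<le> S i"
  by (auto simp: packing_seq_def Suc_le_eq)

lemma packing_seq_first_le: "packing_seq S \<Longrightarrow> i \<ge> 1 \<Longrightarrow> S 1 \<le> S i"
  by (auto simp: packing_seq_def intro: mono_onD)

text \<open>By monotonicity, two elements at distance at most \<open>S 1\<close> are too close for every colour,
  so such elements behave like a clique.\<close>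
lemma card_le_colors_if_close:
  assumes S: "packing_seq S"
    and col: "packing_total_coloring S V E k c"
    and X: "X \<subseteq> V <+> E"
    and close: "\<And>A B. A \<in> X \<Longrightarrow> B \<in> X \<Longrightarrow> A \<noteq> B \<Longrightarrow> tdist V E A B \<le> enat (S 1)"
  shows "card X \<le> k"
proof -
  have range: "c ` X \<subseteq> {1..k}"
    using col X by (auto simp: packing_total_coloring_def)
  have "inj_on c X"
  proof (rule inj_onI, rule ccontr)
    fix A B assume AB: "A \<in> X" "B \<in> X" "c A = c B" "A \<noteq> B"
    then have "tdist V E A B > enat (S (c A))"
      using col X unfolding packing_total_coloring_def by (metis subsetD)
    moreover have "S 1 \<le> S (c A)"
      using range AB(1) by (intro packing_seq_first_le[OF S]) auto
    ultimately show False
      using close[OF AB(1,2,4)] by (meson enat_ord_simps(1) leD order_trans)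
  qed
  then show ?thesis using card_inj_on_le[OF _ range] by simp
qed

lemma degree_less_num_colors:
  assumes S: "packing_seq S" and G: "simple_graph V E" "finite V"
    and col: "packing_total_coloring S V E k c"
    and v: "v \<in> V"
  shows "1 + degree E v \<le> k"
proof -
  let ?I = "{e \<in> E. v \<in> e}"
  have finE: "finite E" using simple_graph_finite_edges[OF G] .
  have fine: "finite e" if "e \<in> E" for e
    using that G by (auto simp: simple_graph_def intro: finite_subset)
  have "card ({v} <+> ?I) \<le> k"
  proof (rule card_le_colors_if_close[OF S col])
    show "{v} <+> ?I \<subseteq> V <+> E" using v by auto
    fix A B assume AB: "A \<in> {v} <+> ?I" "B \<in> {v} <+> ?I" "A \<noteq> B"
    then have "tdist V E A B \<le> 1"
      using v fine tdist_vertex_incident_edge_le[of v V _ E]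
        tdist_edges_sharing_vertex_le[of v V _ _ E]
      by (elim PlusE) (auto simp: tdist_commute[of V E "Inr _" "Inl _"] simp del: tdist.simps)
    also have "1 \<le> enat (S 1)"
      using packing_seq_pos[OF S, of 1] by (simp add: one_enat_def)
    finally show "tdist V E A B \<le> enat (S 1)" .
  qed
  then show ?thesis using finE by (simp add: card_Plus degree_def)
qed

text \<open>The two distant elements share colour 1, the others get the colours from 2 on.\<close>
lemma coloring_merging_pair:
  assumes fin: "finite V" "finite E"
    and AB: "A \<in> V <+> E" "B \<in> V <+> E" "A \<noteq> B"
    and far: "enat (S 1) < tdist V E A B"
  shows "\<exists>c. packing_total_coloring S V E (card V + card E - 1) c"
proof -
  let ?k = "card V + card E - 1"
  let ?R = "(V <+> E) - {A, B}"
  have "card {A, B} \<le> card (V <+> E)"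
    using fin AB by (intro card_mono) auto
  then have "card V + card E \<ge> 2"
    using fin AB by (simp add: card_Plus)
  moreover have "card ?R = card V + card E - 2"
    using fin AB by (simp add: card_Diff_subset card_Plus)
  ultimately have "card ?R = card {2..?k}" by simp
  then obtain g where g: "bij_betw g ?R {2..?k}"
    using fin by (metis finite_same_card_bij finite_atLeastAtMost finite_Plus finite_Diff)
  define c where "c X = (if X \<in> {A, B} then 1 else g X)" for X
  have gR: "g X \<in> {2..?k}" if "X \<in> ?R" for X
    using g that by (auto simp: bij_betw_def)
  have "packing_total_coloring S V E ?k c"
    unfolding packing_total_coloring_def
  proof (intro conjI funcsetI ballI allI impI)
    fix X assume "X \<in> V <+> E"
    then show "c X \<in> {1..?k}"
      using gR[of X] \<open>card V + card E \<ge> 2\<close> by (auto simp: c_def)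
  next
    fix X Y i
    assume XY: "X \<in> V <+> E" "Y \<in> V <+> E" "X \<noteq> Y" and i: "c X = i" "c Y = i"
    have one_iff: "c Z = 1 \<longleftrightarrow> Z \<in> {A, B}" if "Z \<in> V <+> E" for Z
      using gR[of Z] that by (cases "Z \<in> {A, B}") (simp_all add: c_def)
    have "X \<in> {A, B} \<and> Y \<in> {A, B}"
    proof (rule ccontr)
      assume "\<not> (X \<in> {A, B} \<and> Y \<in> {A, B})"
      then have notin: "X \<notin> {A, B}" "Y \<notin> {A, B}"
        using one_iff[OF XY(1)] one_iff[OF XY(2)] i by metis+
      then have "X \<in> ?R" "Y \<in> ?R" "g X = g Y"
        using i XY(1,2) by (simp_all add: c_def)
      then show False using bij_betw_imp_inj_on[OF g] XY(3) by (meson inj_onD)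
    qed
    moreover from this have "i = 1" using one_iff[OF XY(1)] i by simp
    moreover have "enat (S 1) < tdist V E B A"
      using far by (subst tdist_commute)
    ultimately show "enat (S i) < tdist V E X Y"
      using far XY(3) by auto
  qed
  then show ?thesis by blast
qed

theorem mainTheorem2:
  fixes S :: "nat \<Rightarrow> nat" and V :: "'a set" and E :: "'a set set" and n m :: nat
  assumes "packing_seq S"
    and "simple_graph V E"
    and "finite V"
    and "card V = n" and "n \<ge> 1"
    and "card E = m"
  shows "1 + max_degree V E \<le> packing_total_chromatic_number S V E
    \<and> packing_total_chromatic_number S V E \<le> n + m
    \<and> (packing_total_chromatic_number S V E = n + m
        \<longleftrightarrow> graph_connected V E \<and> enat (S 1) \<ge> max_tdist V E)"
proof -
  let ?chi = "packing_total_chromatic_number S V E"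
  have finE: "finite E" using simple_graph_finite_edges[OF assms(2,3)] .
  have chi_le: "?chi \<le> k" if "\<exists>c. packing_total_coloring S V E k c" for k
    unfolding packing_total_chromatic_number_def using that by (rule Least_le)
  have upper: "?chi \<le> n + m"
    using packing_total_coloring_exists[OF assms(3) finE] assms(4,6) by (intro chi_le) blast
  have "\<exists>c. packing_total_coloring S V E ?chi c"
    unfolding packing_total_chromatic_number_def
    by (rule LeastI) (rule packing_total_coloring_exists[OF assms(3) finE])
  then obtain c where c: "packing_total_coloring S V E ?chi c" by blast
  have "V \<noteq> {}" using assms(4,5) by auto
  then have "max_degree V E \<in> degree E ` V"
    unfolding max_degree_def using assms(3) by (intro Max_in) auto
  then have lower: "1 + max_degree V E \<le> ?chi"
    using degree_less_num_colors[OF assms(1,2,3) c] by auto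
  have "?chi = n + m \<longleftrightarrow> max_tdist V E \<le> enat (S 1)"
  proof
    assume eq: "?chi = n + m"
    show "max_tdist V E \<le> enat (S 1)"
      unfolding max_tdist_le_iff[OF assms(3) finE]
    proof (intro ballI impI, rule ccontr)
      fix A B assume "A \<in> V <+> E" "B \<in> V <+> E" "A \<noteq> B" "\<not> tdist V E A B \<le> enat (S 1)"
      then have "?chi \<le> n + m - 1"
        using coloring_merging_pair[OF assms(3) finE, of A B S] assms(4,6)
        by (intro chi_le) auto
      with eq assms(5) show False by simp
    qed
  next
    assume "max_tdist V E \<le> enat (S 1)"
    then have "card (V <+> E) \<le> ?chi"
      using max_tdist_le_iff[OF assms(3) finE]
      by (intro card_le_colors_if_close[OF assms(1) c]) auto
    with upper show "?chi = n + m"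
      using assms(3,4,6) finE by (simp add: card_Plus)
  qed
  moreover have "graph_connected V E" if "max_tdist V E \<le> enat (S 1)"
    by (rule graph_connected_if_close[OF max_tdist_le_iff[OF assms(3) finE, THEN iffD1, OF that]])
  ultimately show ?thesis using lower upper by blast
qed

end
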